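(* Let $\mathcal{H}$ be a separable Hilbert space and let $\{W_i \}_{i\in I}$ be a frame of subspaces with respect to $\{v_i\}_{i \in I}$ for $\mathcal{H}$. Then the following conditions are equivalent. (1) $\{W_i \}_{i\in I}$ is a Riesz decomposition of $\mathcal{H}$. (2) $\{W_i \}_{i\in I}$ is minimal. (3) The synthesis operator $T_{W,v}$ is one-to-one. (4) The analysis operator $T_{W,v}^*$ is onto. Moreover, if $\{W_i \}_{i\in I}$ is a Riesz decomposition of $\mathcal{H}$, then it is also an exact frame of subspaces for $\mathcal{H}$. The opposite implication is not valid.
   Context: For a closed subspace $W$ of $\mathcal{H}$, $\pi_W$ denotes the orthogonal projection onto $W$. Given weights $v_i>0$ ($i\in I$), a family $\{W_i\}_{i\in I}$ of closed subspaces of $\mathcal{H}$ is a frame of subspaces with respect to $\{v_i\}_{i\in I}$ for $\mathcal{H}$ if there are constants $0<C\le D<\infty$ such that $C\|f\|^2 \le \sum_{i\in I} v_i^2\|\pi_{W_i}(f)\|^2 \le D\|f\|^2$ for all $f\in\mathcal{H}$. The space $\left(\sum_{i\in I}\oplus W_i\right)_{\ell_2}$ consists of all families $\{f_i\}_{i\in I}$ with $f_i\in W_i$ and $\sum_{i\in I}\|f_i\|^2<\infty$, with inner product $\sum_{i\in I}\langle f_i,g_i\rangle$. The synthesis operator $T_{W,v}:\left(\sum_{i\in I}\oplus W_i\right)_{\ell_2}\to\mathcal{H}$ is $T_{W,v}(\{f_i\}_{i\in I})=\sum_{i\in I}v_if_i$, and the analysis operator is its adjoint $T_{W,v}^*$.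 A frame of subspaces $\{W_i\}_{i\in I}$ with respect to some family of weights for $\mathcal{H}$ is a Riesz decomposition of $\mathcal{H}$ if for every $f\in\mathcal{H}$ there is a unique choice of $f_i\in W_i$ so that $f=\sum_{i\in I}f_i$. A family of subspaces $\{W_i\}_{i\in I}$ is minimal if $W_i\cap\overline{\mathrm{span}}_{j\in I,\,j\ne i}\{W_j\}=\{0\}$ for each $i\in I$. A frame of subspaces with respect to some family of weights is exact if it ceases to be a frame of subspaces once one element is deleted.
   Formalization: In the "moreover" part (Riesz decomposition implies exact), all subspaces W_i are assumed nonzero; otherwise W_1 = H, W_2 = {0} is a Riesz decomposition that is not exact. *)

theory Defs
  imports "HOL-Analysis.Analysis"
begin

text \<open>
  Hilbert spaces over the reals and over the complex numbers are treated uniformly.  The class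
  below axiomatises the scalar field together with its conjugation (the identity on the reals).
  By the Gelfand--Mazur theorem its only models are the real and the complex numbers.
\<close>

class hilbert_scalar = real_normed_field + banach +
  fixes scnj :: "'a \<Rightarrow> 'a"
  assumes scnj_add: "scnj (a + b) = scnj a + scnj b"
    and scnj_mult: "scnj (a * b) = scnj a * scnj b"
    and scnj_scnj: "scnj (scnj a) = a"
    and scnj_scaleR: "scnj (r *\<^sub>R a) = r *\<^sub>R scnj a"
    and mult_scnj: "a * scnj a = ((norm a)\<^sup>2) *\<^sub>R 1"

instantiation real :: hilbert_scalar
begin
definition scnj_real :: "real \<Rightarrow> real" where "scnj_real x = x"
instance
  by standard (auto simp: scnj_real_def power2_eq_square)
end

instantiation complex :: hilbert_scalar
begin
definition scnj_complex :: "complex \<Rightarrow> complex" where "scnj_complex z = cnj z"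
instance
proof
  fix a :: complex
  show "a * scnj a = ((norm a)\<^sup>2) *\<^sub>R 1"
    unfolding scnj_complex_def complex_norm_square[symmetric] scaleR_conv_of_real by simp
qed (simp_all add: scnj_complex_def)
end

text \<open>
  The topology and the norm are those of the Banach space type \<open>'b\<close>; the inner product is linear
  in its first argument and induces the norm.  The relation between \<open>scale\<close> and real scaling
  says that the real vector space structure of \<open>'b\<close> is the restriction of scalars.
\<close>

locale hilbert_space = vector_space scale
  for scale :: "'k::hilbert_scalar \<Rightarrow> 'b::banach \<Rightarrow> 'b" +
  fixes ip :: "'b \<Rightarrow> 'b \<Rightarrow> 'k"
  assumes scale_of_real: "scale (of_real r) x = r *\<^sub>R x"
    and ip_add_left: "ip (x + y) z = ip x z + ip y z"
    and ip_scale_left: "ip (scale c x) y = c * ip x y"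
    and ip_cnj_commute: "ip y x = scnj (ip x y)"
    and ip_self: "ip x x = of_real ((norm x)\<^sup>2)"

lemma hilbert_space_real:
  "hilbert_space (scaleR :: real \<Rightarrow> 'b \<Rightarrow> 'b) (inner :: 'b::{real_inner, banach} \<Rightarrow> 'b \<Rightarrow> real)"
  by unfold_locales
    (simp_all add: inner_add_left inner_add_right inner_commute scnj_real_def power2_norm_eq_inner
      scaleR_add_right scaleR_add_left)

lemma hilbert_space_complex:
  "hilbert_space ((*) :: complex \<Rightarrow> complex \<Rightarrow> complex) (\<lambda>z w. z * cnj w)"
proof unfold_locales
  fix z :: complex
  show "z * cnj z = of_real ((norm z)\<^sup>2)"
    by (rule complex_norm_square[symmetric])
qed (simp_all add: scnj_complex_def scaleR_conv_of_real distrib_left distrib_right)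

text \<open>
  The adjoint of \<open>T\<close>, for \<open>T\<close> from the inner product space with carrier \<open>A\<close> and inner product
  \<open>ipA\<close> to the inner product space with inner product \<open>ipB\<close> and carrier the whole type.
\<close>

definition hilbert_adjoint ::
  "'a set \<Rightarrow> ('a \<Rightarrow> 'a \<Rightarrow> 'k) \<Rightarrow> ('b \<Rightarrow> 'b \<Rightarrow> 'k) \<Rightarrow> ('a \<Rightarrow> 'b) \<Rightarrow> 'b \<Rightarrow> 'a" where
  "hilbert_adjoint A ipA ipB T y = (THE x. x \<in> A \<and> (\<forall>z\<in>A. ipA z x = ipB (T z) y))"

context hilbert_space
begin

definition closed_subspace :: "'b set \<Rightarrow> bool" where
  "closed_subspace W \<longleftrightarrow> subspace W \<and> closed W"

definition orth_proj :: "'b set \<Rightarrow> 'b \<Rightarrow> 'b" where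
  "orth_proj W x = (THE y. y \<in> W \<and> (\<forall>w\<in>W. ip (x - y) w = 0))"

text \<open>
  Index sets are subsets \<open>I\<close> of an arbitrary type and all sums are unconditional.  Summability
  is required explicitly since \<open>infsum\<close> is \<open>0\<close> on families that are not summable.
\<close>

definition frame_of_subspaces :: "'i set \<Rightarrow> ('i \<Rightarrow> 'b set) \<Rightarrow> ('i \<Rightarrow> real) \<Rightarrow> bool" where
  "frame_of_subspaces I W v \<longleftrightarrow>
     (\<forall>i\<in>I. closed_subspace (W i) \<and> 0 < v i) \<and>
     (\<exists>C D. 0 < C \<and> C \<le> D \<and>
       (\<forall>f. (\<lambda>i. (v i)\<^sup>2 * (norm (orth_proj (W i) f))\<^sup>2) summable_on I \<and>
            C * (norm f)\<^sup>2 \<le> (\<Sum>\<^sub>\<infinity>i\<in>I. (v i)\<^sup>2 * (norm (orth_proj (W i) f))\<^sup>2) \<and>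
            (\<Sum>\<^sub>\<infinity>i\<in>I. (v i)\<^sup>2 * (norm (orth_proj (W i) f))\<^sup>2) \<le> D * (norm f)\<^sup>2))"

text \<open>
  Families indexed by \<open>I\<close> are represented by functions that vanish outside \<open>I\<close>, so that each
  family has exactly one representative.
\<close>

definition families :: "'i set \<Rightarrow> ('i \<Rightarrow> 'b set) \<Rightarrow> ('i \<Rightarrow> 'b) set" where
  "families I W = {f. (\<forall>i\<in>I. f i \<in> W i) \<and> (\<forall>i. i \<notin> I \<longrightarrow> f i = 0)}"

definition l2_sum :: "'i set \<Rightarrow> ('i \<Rightarrow> 'b set) \<Rightarrow> ('i \<Rightarrow> 'b) set" where
  "l2_sum I W = {f \<in> families I W. (\<lambda>i. (norm (f i))\<^sup>2) summable_on I}"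

definition l2_ip :: "'i set \<Rightarrow> ('i \<Rightarrow> 'b) \<Rightarrow> ('i \<Rightarrow> 'b) \<Rightarrow> 'k" where
  "l2_ip I f g = (\<Sum>\<^sub>\<infinity>i\<in>I. ip (f i) (g i))"

definition synthesis :: "'i set \<Rightarrow> ('i \<Rightarrow> real) \<Rightarrow> ('i \<Rightarrow> 'b) \<Rightarrow> 'b" where
  "synthesis I v f = (\<Sum>\<^sub>\<infinity>i\<in>I. v i *\<^sub>R f i)"

definition analysis :: "'i set \<Rightarrow> ('i \<Rightarrow> 'b set) \<Rightarrow> ('i \<Rightarrow> real) \<Rightarrow> 'b \<Rightarrow> ('i \<Rightarrow> 'b)" where
  "analysis I W v = hilbert_adjoint (l2_sum I W) (l2_ip I) ip (synthesis I v)"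

definition riesz_decomposition :: "'i set \<Rightarrow> ('i \<Rightarrow> 'b set) \<Rightarrow> bool" where
  "riesz_decomposition I W \<longleftrightarrow>
     (\<exists>v. frame_of_subspaces I W v) \<and>
     (\<forall>f. \<exists>!g. g \<in> families I W \<and> (g has_sum f) I)"

definition minimal_family :: "'i set \<Rightarrow> ('i \<Rightarrow> 'b set) \<Rightarrow> bool" where
  "minimal_family I W \<longleftrightarrow>
     (\<forall>i\<in>I. W i \<inter> closure (span (\<Union>j\<in>I - {i}. W j)) = {0})"

text \<open>
  Exactness is a property of the subspaces: after a deletion no choice of weights gives a frame
  of subspaces.  In particular, if \<open>frame_of_subspaces I W v\<close> holds, then the remaining subspaces
  are not a frame of subspaces with respect to the remaining weights \<open>v\<close>.
\<close>

definition exact_frame_of_subspaces :: "'i set \<Rightarrow> ('i \<Rightarrow> 'b set) \<Rightarrow> bool" where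
  "exact_frame_of_subspaces I W \<longleftrightarrow>
     (\<exists>v. frame_of_subspaces I W v) \<and>
     (\<forall>i\<in>I. \<not> (\<exists>u. frame_of_subspaces (I - {i}) W u))"

end

end

theory Submission
  imports Defs
begin

text \<open>
  Write \<open>T\<close> for the synthesis operator of a frame of subspaces with bounds \<open>C \<le> D\<close>.  Its adjoint sends
  \<open>x\<close> to the family \<open>v i *\<^sub>R orth_proj (W i) x\<close>, so that
  \<open>\<langle>T (T\<^sup>* x), x\<rangle> = (\<Sum>\<^sub>\<infinity>i\<in>I. (v i)\<^sup>2 * (norm (orth_proj (W i) x))\<^sup>2)\<close>: the frame inequalities say that
  \<open>S = T T\<^sup>*\<close> is bounded and bounded below as a quadratic form.  Hence \<open>S\<close> is onto
  (\<open>frame_operator_surj\<close>), and every vector is the sum of some family with terms in the \<open>W i\<close>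
  (\<open>ex_expansion\<close>).  Given this, the four conditions are linked in a cycle.

  \<^item> Riesz decomposition \<open>\<Longrightarrow>\<close> \<open>T\<close> one-to-one: \<open>T c\<close> is the sum of the family \<open>v i *\<^sub>R c i\<close>, which
    determines \<open>c\<close> because the weights are positive.
  \<^item> \<open>T\<close> one-to-one \<open>\<Longrightarrow>\<close> \<open>T\<^sup>*\<close> onto: given \<open>c\<close>, choose \<open>x\<close> with \<open>S x = T c\<close>; then \<open>T (T\<^sup>* x) = T c\<close> gives
    \<open>T\<^sup>* x = c\<close>.
  \<^item> \<open>T\<^sup>*\<close> onto \<open>\<Longrightarrow>\<close> minimal: for \<open>x \<in> W i\<close> choose \<open>y\<close> such that \<open>T\<^sup>* y\<close> is \<open>x\<close> at \<open>i\<close> and \<open>0\<close>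
    elsewhere.  Then \<open>y\<close> is orthogonal to every other \<open>W j\<close>, so if \<open>x\<close> lies in their closed span,
    then \<open>\<langle>x, y\<rangle> = 0\<close>; but \<open>v i * \<langle>x, y\<rangle> = \<langle>x, x\<rangle>\<close>.
  \<^item> minimal \<open>\<Longrightarrow>\<close> Riesz decomposition: existence is \<open>ex_expansion\<close>, and the difference of two
    expansions expresses each of its terms through the other ones.

  A Riesz decomposition into nonzero subspaces is exact since, if the subspaces other than \<open>W i\<close>
  formed a frame, they would give a second expansion of a nonzero vector of \<open>W i\<close>.  Conversely, two
  coordinate planes in dimension three that meet in a line form a frame, neither plane alone does,
  and the vectors on that line have several expansions.
\<close>

section \<open>Scalars\<close>

lemma scnj_of_real [simp]: "scnj (of_real r :: 'k::hilbert_scalar) = of_real r"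
proof -
  have "scnj (1::'k) = 1"
    using mult_scnj[of "1::'k"] by simp
  then show ?thesis
    by (simp add: of_real_def scnj_scaleR)
qed

lemma scnj_0 [simp]: "scnj (0::'k::hilbert_scalar) = 0"
  using scnj_of_real[of 0] by simp

lemma scnj_diff: "scnj (a - b) = scnj a - scnj (b::'k::hilbert_scalar)"
  using scnj_add[of "a - b" b] by (simp add: algebra_simps)

lemma mult_scnj': "a * scnj a = of_real ((norm (a::'k::hilbert_scalar))\<^sup>2)"
  by (simp only: mult_scnj of_real_def)

lemma scnj_eq_0_iff [simp]: "scnj a = 0 \<longleftrightarrow> a = (0::'k::hilbert_scalar)"
  by (metis scnj_0 scnj_scnj)

text \<open>
  A fixed scalar satisfies \<open>a\<^sup>2 = a * scnj a = (norm a)\<^sup>2\<close>, and a field has no further square roots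
  than \<open>norm a\<close> and \<open>- norm a\<close>.
\<close>

lemma scnj_fixed_imp_real:
  assumes "scnj a = (a::'k::hilbert_scalar)"
  shows "\<exists>r. a = of_real r"
proof -
  have "a\<^sup>2 = (of_real (norm a))\<^sup>2"
    using mult_scnj'[of a] assms by (simp add: power2_eq_square)
  then have "a = of_real (norm a) \<or> a = of_real (- norm a)"
    by (simp add: power2_eq_iff)
  then show ?thesis by blast
qed

text \<open>
  Every scalar is half the sum of a fixed and an anti-fixed scalar.  The fixed ones are real, and so
  is the quotient of two anti-fixed ones, whence any nonzero anti-fixed scalar can be taken for \<open>e\<close>.
  If there is none, as over the reals, then \<open>e = 0\<close>.
\<close>

lemma hilbert_scalar_two_dimensional:
  "\<exists>e::'k::hilbert_scalar. \<forall>a. \<exists>r s. a = of_real r + s *\<^sub>R e"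
proof -
  obtain e :: 'k where e: "scnj e = - e"
    and e_max: "e = 0 \<Longrightarrow> \<forall>b::'k. scnj b = - b \<longrightarrow> b = 0"
    by (metis minus_zero scnj_0)
  have "\<exists>r s. a = of_real r + s *\<^sub>R e" for a
  proof -
    have "scnj (a + scnj a) = a + scnj a"
      by (simp add: scnj_add scnj_scnj add.commute)
    then obtain r where r: "a + scnj a = of_real r"
      using scnj_fixed_imp_real by blast
    have anti: "scnj (a - scnj a) = - (a - scnj a)"
      by (simp add: scnj_diff scnj_scnj)
    have "\<exists>s. a - scnj a = of_real s * e"
    proof (cases "e = 0")
      case True
      then have "a - scnj a = 0" using e_max anti by blast
      then show ?thesis by simp
    next
      case False
      define q where "q = (a - scnj a) / e"
      have qe: "q * e = a - scnj a" using False by (simp add: q_def)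
      have "scnj q * (- e) = scnj (q * e)"
        by (simp only: scnj_mult e)
      also have "\<dots> = - (q * e)"
        unfolding qe by (rule anti)
      finally have "scnj q * (- e) = - (q * e)" .
      then have "scnj q = q" using False by simp
      then obtain s where "q = of_real s"
        using scnj_fixed_imp_real by blast
      then show ?thesis using qe by metis
    qed
    then obtain s where s: "a - scnj a = of_real s * e" by blast
    have "2 * a = (a + scnj a) + (a - scnj a)" by simp
    then have "2 * a = of_real r + of_real s * e"
      by (simp only: r s)
    then have "a = (of_real r + of_real s * e) / 2"
      by (simp add: eq_divide_eq mult.commute)
    then have "a = of_real (r / 2) + (s / 2) *\<^sub>R e"
      by (simp add: scaleR_conv_of_real add_divide_distrib)
    then show ?thesis by blast
  qed
  then show ?thesis by (intro exI[of _ e] allI)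
qed

text \<open>
  Real and imaginary coordinates exhibit the space as a continuous image of a Euclidean space.
\<close>

lemma separable_space_hilbert_scalar_vec:
  "separable_space (euclidean :: ('k::hilbert_scalar ^ 'n) topology)"
proof -
  obtain e :: 'k where e: "\<And>a. \<exists>r s. a = of_real r + s *\<^sub>R e"
    using hilbert_scalar_two_dimensional by blast
  define h :: "(real \<times> real) ^ 'n \<Rightarrow> 'k ^ 'n"
    where "h p = (\<chi> i. of_real (fst (p $ i)) + snd (p $ i) *\<^sub>R e)" for p
  have "continuous_on UNIV h"
    unfolding h_def by (intro continuous_intros)
  moreover have "surj h"
  proof (rule surjI)
    fix x :: "'k ^ 'n"
    define f where "f a = (SOME p. a = of_real (fst p) + snd p *\<^sub>R e)" for a
    have f: "a = of_real (fst (f a)) + snd (f a) *\<^sub>R e" for a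
      unfolding f_def using e[of a] by (intro someI_ex[of "\<lambda>p. a = of_real (fst p) + snd p *\<^sub>R e"]) auto
    show "h (\<chi> i. f (x $ i)) = x"
      by (simp add: h_def vec_eq_iff f[symmetric])
  qed
  moreover have "separable_space (euclidean :: ((real \<times> real) ^ 'n) topology)"
  proof -
    obtain C :: "((real \<times> real) ^ 'n) set" where C: "countable C" "\<And>U. open U \<Longrightarrow> U \<noteq> {} \<Longrightarrow> \<exists>y\<in>C. y \<in> U"
      using countable_dense_exists by blast
    have "closure C = UNIV"
    proof (rule ccontr)
      assume "closure C \<noteq> UNIV"
      then have "- closure C \<noteq> {}" "open (- closure C)" by auto
      then show False using C(2) closure_subset by blast
    qed
    then show ?thesis
      using C(1) by (auto simp: separable_space_def)
  qed
  ultimately show ?thesis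
    by (intro separable_space_continuous_map_image[of euclidean euclidean h]) auto
qed

section \<open>Unconditional sums\<close>

text \<open>
  The Cauchy criterion for nets of partial sums.  It gives the convergence of synthesis series,
  which in general do not converge absolutely.
\<close>

lemma summable_on_if_norm_sum_squared_le:
  fixes f :: "'i \<Rightarrow> 'a::banach"
  assumes g: "g summable_on A"
    and le: "\<And>F. finite F \<Longrightarrow> F \<subseteq> A \<Longrightarrow> (norm (sum f F))\<^sup>2 \<le> sum g F"
  shows "f summable_on A"
proof -
  obtain L where lim: "(sum g \<longlongrightarrow> L) (finite_subsets_at_top A)"
    using g unfolding has_sum_def summable_on_def by blast
  have "\<exists>P. eventually P (finite_subsets_at_top A) \<and>
          (\<forall>F F'. P F \<and> P F' \<longrightarrow> dist (sum f F) (sum f F') < e)" if "e > 0" for e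
  proof -
    have "eventually (\<lambda>F. dist (sum g F) L < (e/2)\<^sup>2 / 2) (finite_subsets_at_top A)"
      using lim that unfolding tendsto_iff
      by (meson half_gt_zero zero_less_power)
    then obtain F0 where F0: "finite F0" "F0 \<subseteq> A"
      and close: "\<And>F. finite F \<Longrightarrow> F0 \<subseteq> F \<Longrightarrow> F \<subseteq> A \<Longrightarrow> dist (sum g F) L < (e/2)\<^sup>2 / 2"
      unfolding eventually_finite_subsets_at_top by metis
    have dist_F0: "dist (sum f F) (sum f F0) < e / 2" if F: "finite F" "F0 \<subseteq> F" "F \<subseteq> A" for F
    proof -
      have "(dist (sum f F) (sum f F0))\<^sup>2 = (norm (sum f (F - F0)))\<^sup>2"
        using F by (simp add: dist_norm sum_diff)
      also have "\<dots> \<le> sum g (F - F0)"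
        using F by (intro le) auto
      also have "\<dots> = sum g F - sum g F0"
        using F by (simp add: sum_diff)
      also have "\<dots> < (e/2)\<^sup>2"
        using close[OF F] close[OF F0(1) order_refl F0(2)] unfolding dist_real_def by arith
      finally show ?thesis
        using \<open>e > 0\<close> power2_less_imp_less by (metis half_gt_zero less_eq_real_def)
    qed
    have "eventually (\<lambda>F. finite F \<and> F0 \<subseteq> F \<and> F \<subseteq> A) (finite_subsets_at_top A)"
      using F0 by (auto simp: eventually_finite_subsets_at_top)
    moreover have "dist (sum f F) (sum f F') < e"
      if "finite F \<and> F0 \<subseteq> F \<and> F \<subseteq> A" "finite F' \<and> F0 \<subseteq> F' \<and> F' \<subseteq> A" for F F'
      using that by (intro dist_triangle_half_l[OF dist_F0 dist_F0]) auto
    ultimately show ?thesis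
      by (intro exI[of _ "\<lambda>F. finite F \<and> F0 \<subseteq> F \<and> F \<subseteq> A"] conjI allI impI) auto
  qed
  then have "cauchy_filter (filtermap (sum f) (finite_subsets_at_top A))"
    by (simp add: cauchy_filter_metric_filtermap)
  moreover have "complete (UNIV::'a set)"
    by (meson Cauchy_convergent UNIV_I complete_def convergent_def)
  ultimately obtain L' where "(sum f \<longlongrightarrow> L') (finite_subsets_at_top A)"
    using complete_uniform[where S=UNIV] by (force simp add: filterlim_def)
  then show ?thesis
    using summable_on_def has_sum_def by blast
qed

lemma has_sum_minus:
  fixes f g :: "'i \<Rightarrow> 'a::topological_ab_group_add"
  assumes "(f has_sum a) A" "(g has_sum b) A"
  shows "((\<lambda>i. f i - g i) has_sum (a - b)) A"
  using has_sum_add[OF assms(1), of "\<lambda>i. - g i" "- b"] assms(2)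
  by (simp add: has_sum_uminus)

lemma has_sum_single:
  fixes f :: "'i \<Rightarrow> 'a::{comm_monoid_add, topological_space}"
  assumes "i \<in> I" "\<And>j. j \<noteq> i \<Longrightarrow> f j = 0"
  shows "(f has_sum f i) I"
  using assms by (intro has_sum_finite_neutralI[where B = "{i}"]) auto

section \<open>Inner products and orthogonal projections\<close>

context hilbert_space
begin

lemma ip_scaleR_left: "ip (r *\<^sub>R x) y = of_real r * ip x y"
  using ip_scale_left[of "of_real r" x y] by (simp add: scale_of_real)

lemma ip_minus_left: "ip (- x) y = - ip x y"
  using ip_scaleR_left[of "-1" x y] by simp

lemma ip_zero_left [simp]: "ip 0 y = 0"
  using ip_scaleR_left[of 0 0 y] by simp

lemma ip_zero_right [simp]: "ip x 0 = 0"
  using ip_cnj_commute[of 0 x] by simp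

lemma ip_diff_left: "ip (x - y) z = ip x z - ip y z"
  using ip_add_left[of x "- y" z] by (simp add: ip_minus_left)

lemma ip_diff_right: "ip x (y - z) = ip x y - ip x z"
  by (metis ip_cnj_commute ip_diff_left scnj_diff)

lemma ip_add_right: "ip x (y + z) = ip x y + ip x z"
  by (metis ip_cnj_commute ip_add_left scnj_add)

lemma ip_scale_right: "ip x (scale c y) = scnj c * ip x y"
  by (metis ip_cnj_commute ip_scale_left scnj_mult)

lemma ip_scaleR_right: "ip x (r *\<^sub>R y) = of_real r * ip x y"
  using ip_scale_right[of x "of_real r" y] by (simp add: scale_of_real)

lemma ip_sum_left: "ip (sum f F) y = (\<Sum>i\<in>F. ip (f i) y)"
  by (induction F rule: infinite_finite_induct) (auto simp: ip_add_left)

lemma ip_eq_zero_commute: "ip x y = 0 \<longleftrightarrow> ip y x = 0"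
  by (metis ip_cnj_commute scnj_0)

lemma ip_self_eq_zero [simp]: "ip x x = 0 \<longleftrightarrow> x = 0"
  by (simp add: ip_self)

text \<open>
  Subtracting from \<open>z\<close> its projection on the line through \<open>w\<close> lowers the squared norm by an explicit
  amount.  That the result is nonnegative is the Cauchy--Schwarz inequality, and that it cannot fall
  below the minimum makes the residual of a nearest point orthogonal to the subspace.
\<close>

lemma norm_diff_projection_on_line:
  assumes "w \<noteq> 0"
  shows "(norm (z - scale (ip z w / of_real ((norm w)\<^sup>2)) w))\<^sup>2 =
    (norm z)\<^sup>2 - (norm (ip z w))\<^sup>2 / (norm w)\<^sup>2"
proof -
  define a where "a = ip z w"
  define n where "n = (norm w)\<^sup>2"
  have n: "n \<noteq> 0" using assms by (simp add: n_def)
  define c where "c = a / of_real n"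
  have "of_real ((norm (z - scale c w))\<^sup>2) = ip (z - scale c w) (z - scale c w)"
    by (simp add: ip_self)
  also have "\<dots> = ip z z - scnj c * a - c * scnj a + c * scnj c * of_real n"
    by (simp add: ip_diff_left ip_diff_right ip_scale_left ip_scale_right ip_self[of w] n_def
        ip_cnj_commute[of w z] a_def algebra_simps)
  also have "c * scnj c * of_real n = scnj c * a"
    using n by (simp add: c_def)
  also have "c * scnj a = of_real ((norm a)\<^sup>2 / n)"
    using mult_scnj'[of a] by (simp add: c_def)
  also have "ip z z - scnj c * a - of_real ((norm a)\<^sup>2 / n) + scnj c * a =
      of_real ((norm z)\<^sup>2 - (norm a)\<^sup>2 / n)"
    by (simp add: ip_self)
  finally show ?thesis
    unfolding of_real_eq_iff a_def n_def c_def .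
qed

lemma norm_ip_le: "norm (ip x y) \<le> norm x * norm y"
proof (cases "y = 0")
  case False
  have "0 \<le> (norm x)\<^sup>2 - (norm (ip x y))\<^sup>2 / (norm y)\<^sup>2"
    using norm_diff_projection_on_line[OF False, of x] by (metis zero_le_power2)
  then have "(norm (ip x y))\<^sup>2 \<le> (norm x * norm y)\<^sup>2"
    using False by (simp add: field_simps power_mult_distrib)
  then show ?thesis
    by (rule power2_le_imp_le) simp
qed simp

lemma bounded_linear_ip_left: "bounded_linear (\<lambda>x. ip x y)"
  by (rule bounded_linear_intro[where K = "norm y"])
    (auto simp: ip_add_left ip_scaleR_left scaleR_conv_of_real norm_ip_le)

lemma parallelogram: "(norm (x + y :: 'b))\<^sup>2 + (norm (x - y))\<^sup>2 = 2 * (norm x)\<^sup>2 + 2 * (norm y)\<^sup>2"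
proof -
  have "of_real ((norm (x + y))\<^sup>2 + (norm (x - y))\<^sup>2) = ip (x + y) (x + y) + ip (x - y) (x - y)"
    by (simp only: of_real_add ip_self)
  also have "\<dots> = 2 * ip x x + 2 * ip y y"
    by (simp add: ip_add_left ip_add_right ip_diff_left ip_diff_right)
  also have "\<dots> = of_real (2 * (norm x)\<^sup>2 + 2 * (norm y)\<^sup>2)"
    by (simp add: ip_self)
  finally show ?thesis unfolding of_real_eq_iff .
qed

lemma subspace_scaleR: "subspace W \<Longrightarrow> x \<in> W \<Longrightarrow> r *\<^sub>R x \<in> W"
  using subspace_scale[of W x "of_real r"] by (simp add: scale_of_real)

text \<open>
  By the parallelogram law, two points of \<open>W\<close> that almost minimise the distance to \<open>x\<close> are close to
  each other, since their midpoint is not closer to \<open>x\<close> than the infimum.  Minimising sequences are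
  therefore Cauchy.
\<close>

lemma ex_nearest_point:
  assumes W: "closed_subspace W"
  shows "\<exists>y\<in>W. \<forall>w\<in>W. norm (x - y) \<le> norm (x - w)"
proof -
  have sub: "subspace W" and "closed W"
    using W by (auto simp: closed_subspace_def)
  define \<delta> where "\<delta> = (INF w\<in>W. (norm (x - w))\<^sup>2)"
  have bdd: "bdd_below ((\<lambda>w. (norm (x - w))\<^sup>2) ` W)"
    by (rule bdd_belowI[of _ 0]) auto
  have "W \<noteq> {}" using subspace_0[OF sub] by blast
  have \<delta>_le: "\<delta> \<le> (norm (x - w))\<^sup>2" if "w \<in> W" for w
    unfolding \<delta>_def using bdd that by (rule cINF_lower)
  have "\<exists>w\<in>W. (norm (x - w))\<^sup>2 < \<delta> + inverse (real (Suc n))" for n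
    using cInf_lessD[of "(\<lambda>w. (norm (x - w))\<^sup>2) ` W" "\<delta> + inverse (real (Suc n))"] \<open>W \<noteq> {}\<close>
    by (auto simp: \<delta>_def)
  then obtain u where u: "\<And>n. u n \<in> W" "\<And>n. (norm (x - u n))\<^sup>2 < \<delta> + inverse (real (Suc n))"
    by metis
  have u_dist: "(norm (u m - u n))\<^sup>2 \<le> 2 * inverse (real (Suc m)) + 2 * inverse (real (Suc n))" for m n
  proof -
    have "(1/2) *\<^sub>R (u m + u n) \<in> W"
      using sub u(1) by (intro subspace_scaleR subspace_add)
    then have "4 * \<delta> \<le> 4 * (norm (x - (1/2) *\<^sub>R (u m + u n)))\<^sup>2"
      using \<delta>_le by simp
    also have "\<dots> = (norm (2 *\<^sub>R (x - (1/2) *\<^sub>R (u m + u n))))\<^sup>2"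
      by (simp only: norm_scaleR power_mult_distrib) simp
    also have "2 *\<^sub>R (x - (1/2) *\<^sub>R (u m + u n)) = (x - u m) + (x - u n)"
      by (simp add: scaleR_2 algebra_simps)
    finally have "4 * \<delta> \<le> (norm ((x - u m) + (x - u n)))\<^sup>2" .
    moreover have "(x - u m) - (x - u n) = u n - u m" by simp
    ultimately show ?thesis
      using parallelogram[of "x - u m" "x - u n"] u(2)[of m] u(2)[of n]
      by (simp add: norm_minus_commute)
  qed
  have "Cauchy u"
  proof (rule CauchyI)
    fix e :: real assume "e > 0"
    then obtain N where N: "inverse (real (Suc N)) < e\<^sup>2 / 4"
      using reals_Archimedean[of "e\<^sup>2 / 4"] by auto
    have "norm (u m - u n) < e" if "m \<ge> N" "n \<ge> N" for m n
    proof -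
      have "inverse (real (Suc m)) \<le> inverse (real (Suc N))"
        "inverse (real (Suc n)) \<le> inverse (real (Suc N))"
        using that by (auto intro!: le_imp_inverse_le)
      then have "(norm (u m - u n))\<^sup>2 < e\<^sup>2"
        using u_dist[of m n] N by linarith
      then show ?thesis
        using \<open>e > 0\<close> by (intro power2_less_imp_less[of _ e]) auto
    qed
    then show "\<exists>M. \<forall>m\<ge>M. \<forall>n\<ge>M. norm (u m - u n) < e" by blast
  qed
  then obtain y where y: "u \<longlonglongrightarrow> y"
    using Cauchy_convergent convergent_def by blast
  have "y \<in> W"
    using \<open>closed W\<close> u(1) y closed_sequentially by blast
  have "(\<lambda>n. (norm (x - u n))\<^sup>2) \<longlonglongrightarrow> (norm (x - y))\<^sup>2"
    by (intro tendsto_intros y)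
  moreover have "(\<lambda>n. \<delta> + inverse (real (Suc n))) \<longlonglongrightarrow> \<delta> + 0"
    by (intro tendsto_intros LIMSEQ_inverse_real_of_nat)
  ultimately have "(norm (x - y))\<^sup>2 \<le> \<delta> + 0"
    by (rule LIMSEQ_le) (meson less_imp_le u(2))
  then have "(norm (x - y))\<^sup>2 \<le> (norm (x - w))\<^sup>2" if "w \<in> W" for w
    using \<delta>_le[OF that] by linarith
  then show ?thesis
    using \<open>y \<in> W\<close> by (intro bexI[of _ y] ballI power2_le_imp_le[OF _ norm_ge_zero])
qed

lemma orth_proj_ex1:
  assumes W: "closed_subspace W"
  shows "\<exists>!y. y \<in> W \<and> (\<forall>w\<in>W. ip (x - y) w = 0)"
proof -
  have sub: "subspace W"
    using W by (auto simp: closed_subspace_def)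
  obtain y where y: "y \<in> W" "\<And>w. w \<in> W \<Longrightarrow> norm (x - y) \<le> norm (x - w)"
    using ex_nearest_point[OF W] by blast
  have "ip (x - y) w = 0" if "w \<in> W" for w
  proof (cases "w = 0")
    case False
    \<comment> \<open>the competitor \<open>y + c w\<close> would be nearer to \<open>x\<close> than \<open>y\<close> if \<open>ip (x - y) w\<close> were nonzero\<close>
    define c where "c = ip (x - y) w / of_real ((norm w)\<^sup>2)"
    have "(norm (x - y))\<^sup>2 \<le> (norm (x - y - scale c w))\<^sup>2"
      using y(2)[of "y + scale c w"] that y(1) sub
      by (intro power_mono) (auto simp: subspace_add subspace_scale diff_diff_eq)
    then have "(norm (ip (x - y) w))\<^sup>2 / (norm w)\<^sup>2 \<le> 0"
      using norm_diff_projection_on_line[OF False, of "x - y"] unfolding c_def by linarith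
    with False show ?thesis
      by (simp add: divide_le_0_iff)
  qed simp
  moreover have "y' = y" if "y' \<in> W" "\<forall>w\<in>W. ip (x - y') w = 0" for y'
  proof -
    have "y' - y \<in> W"
      using that y(1) sub by (simp add: subspace_diff)
    then have "ip (x - y) (y' - y) = 0" "ip (x - y') (y' - y) = 0"
      using that calculation by auto
    moreover have "y' - y = (x - y) - (x - y')" by simp
    ultimately have "ip (y' - y) (y' - y) = 0"
      by (metis ip_diff_left diff_self)
    then show ?thesis by simp
  qed
  ultimately show ?thesis
    using y(1) by blast
qed

lemma orth_proj_in: "closed_subspace W \<Longrightarrow> orth_proj W x \<in> W"
  and ip_orth_proj_residual: "closed_subspace W \<Longrightarrow> w \<in> W \<Longrightarrow> ip (x - orth_proj W x) w = 0"
  using theI'[OF orth_proj_ex1, of W x] by (auto simp: orth_proj_def)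

lemma orth_proj_eqI:
  assumes "closed_subspace W" "y \<in> W" "\<And>w. w \<in> W \<Longrightarrow> ip (x - y) w = 0"
  shows "orth_proj W x = y"
  unfolding orth_proj_def
  using assms by (intro the1_equality orth_proj_ex1) auto

lemma ip_orth_proj:
  assumes "closed_subspace W" "w \<in> W"
  shows "ip w (orth_proj W x) = ip w x"
  using ip_orth_proj_residual[OF assms, of x] ip_eq_zero_commute
  by (metis ip_diff_right right_minus_eq)

lemma orth_proj_diff:
  assumes W: "closed_subspace W"
  shows "orth_proj W (x - y) = orth_proj W x - orth_proj W y"
proof (rule orth_proj_eqI[OF W])
  show "orth_proj W x - orth_proj W y \<in> W"
    using W by (simp add: closed_subspace_def orth_proj_in subspace_diff)
  fix w assume "w \<in> W"
  then show "ip (x - y - (orth_proj W x - orth_proj W y)) w = 0"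
    using ip_orth_proj_residual[OF W, of w x] ip_orth_proj_residual[OF W, of w y]
    by (simp add: ip_diff_left)
qed

lemma closed_ip_kernel: "closed {x. ip x y = 0}"
  using bounded_linear.continuous_on[OF bounded_linear_ip_left continuous_on_id, of UNIV y]
  by (intro closed_Collect_eq) auto

lemma subspace_ip_kernel: "subspace {x. ip x y = 0}"
  by (intro subspaceI) (auto simp: ip_add_left ip_scale_left)

text \<open>
  The vectors orthogonal to \<open>y\<close> form a closed subspace.
\<close>

lemma ip_eq_0_on_closure_span:
  assumes "\<And>x. x \<in> S \<Longrightarrow> ip x y = 0" "x \<in> closure (span S)"
  shows "ip x y = 0"
proof -
  have "span S \<subseteq> {x. ip x y = 0}"
    using assms(1) by (intro span_minimal subspace_ip_kernel) auto
  then have "closure (span S) \<subseteq> {x. ip x y = 0}"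
    by (intro closure_minimal closed_ip_kernel)
  with assms(2) show ?thesis by auto
qed

lemma has_sum_in_closure_span:
  assumes "(f has_sum x) A" "\<And>i. i \<in> A \<Longrightarrow> f i \<in> S"
  shows "x \<in> closure (span S)"
proof (rule Lim_in_closed_set[of _ "sum f"])
  show "(sum f \<longlongrightarrow> x) (finite_subsets_at_top A)"
    using assms(1) by (simp add: has_sum_def)
  have "finite F \<and> F \<subseteq> A \<Longrightarrow> sum f F \<in> closure (span S)" for F
    using assms(2) by (intro subsetD[OF closure_subset] span_sum span_base) auto
  then show "\<forall>\<^sub>F F in finite_subsets_at_top A. sum f F \<in> closure (span S)"
    by (intro eventually_finite_subsets_at_top_weakI) auto
qed auto

section \<open>Families and minimality\<close>

text \<open>
  If \<open>d\<close> is the difference of two expansions, then \<open>d i\<close> is minus the sum of the remaining terms, so it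
  lies both in \<open>W i\<close> and in the closed span of the other subspaces.
\<close>

lemma minimal_unique_sum:
  assumes sub: "\<And>i. i \<in> I \<Longrightarrow> subspace (W i)"
    and minimal: "minimal_family I W"
    and g: "g \<in> families I W" "(g has_sum x) I"
    and h: "h \<in> families I W" "(h has_sum x) I"
  shows "g = h"
proof
  fix i
  show "g i = h i"
  proof (cases "i \<in> I")
    case True
    define d where "d = (\<lambda>j. g j - h j)"
    have d_in: "d j \<in> W j" if "j \<in> I" for j
      using that g(1) h(1) sub by (simp add: d_def families_def subspace_diff)
    have "(d has_sum (x - x)) I"
      unfolding d_def by (intro has_sum_minus g h)
    moreover have "(d has_sum d i) {i}"
      by (rule has_sum_finiteI) auto
    ultimately have "(d has_sum (x - x - d i)) (I - {i})"
      using True by (intro has_sum_Diff) auto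
    then have "((\<lambda>j. - d j) has_sum d i) (I - {i})"
      by (simp add: has_sum_uminus)
    then have "d i \<in> closure (span (\<Union>j\<in>I - {i}. W j))"
    proof (rule has_sum_in_closure_span)
      fix j assume j: "j \<in> I - {i}"
      then have "- d j \<in> W j"
        by (intro subspace_neg sub d_in) auto
      with j show "- d j \<in> (\<Union>j\<in>I - {i}. W j)" by blast
    qed
    with d_in[OF True] minimal True have "d i = 0"
      unfolding minimal_family_def by blast
    then show ?thesis by (simp add: d_def)
  next
    case False
    with g(1) h(1) show ?thesis by (simp add: families_def)
  qed
qed

definition single :: "'i \<Rightarrow> 'b \<Rightarrow> 'i \<Rightarrow> 'b" where
  "single i x = (\<lambda>j. if j = i then x else 0)"

lemma single_in_families:
  assumes "\<And>j. j \<in> I \<Longrightarrow> subspace (W j)" "i \<in> I" "x \<in> W i"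
  shows "single i x \<in> families I W"
  using assms by (auto simp: single_def families_def subspace_0)

end

section \<open>Frames of subspaces with given bounds\<close>

locale subspace_frame = hilbert_space scale ip
  for scale :: "'k::hilbert_scalar \<Rightarrow> 'b::banach \<Rightarrow> 'b" and ip +
  fixes I :: "'i set" and W :: "'i \<Rightarrow> 'b set" and v :: "'i \<Rightarrow> real" and C D :: real
  assumes closed_subspace: "i \<in> I \<Longrightarrow> closed_subspace (W i)"
    and weight_pos: "i \<in> I \<Longrightarrow> 0 < v i"
    and lower_pos: "0 < C"
    and lower_le_upper: "C \<le> D"
    and energy_summable: "(\<lambda>i. (v i)\<^sup>2 * (norm (orth_proj (W i) x))\<^sup>2) summable_on I"
    and energy_lower: "C * (norm x)\<^sup>2 \<le> (\<Sum>\<^sub>\<infinity>i\<in>I. (v i)\<^sup>2 * (norm (orth_proj (W i) x))\<^sup>2)"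
    and energy_upper: "(\<Sum>\<^sub>\<infinity>i\<in>I. (v i)\<^sup>2 * (norm (orth_proj (W i) x))\<^sup>2) \<le> D * (norm x)\<^sup>2"

lemma (in hilbert_space) frame_of_subspacesE:
  assumes "frame_of_subspaces I W v"
  obtains C D where "subspace_frame scale ip I W v C D"
  using assms that hilbert_space_axioms
  unfolding frame_of_subspaces_def subspace_frame_def subspace_frame_axioms_def by blast

context subspace_frame
begin

lemma subspace_W: "i \<in> I \<Longrightarrow> subspace (W i)"
  using closed_subspace by (simp add: closed_subspace_def)

text \<open>
  The adjoint of the synthesis operator; \<open>analysis_eq_coeffs\<close> identifies it with \<open>analysis\<close>.
\<close>

definition coeffs :: "'b \<Rightarrow> 'i \<Rightarrow> 'b" where
  "coeffs x = (\<lambda>i. if i \<in> I then v i *\<^sub>R orth_proj (W i) x else 0)"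

definition energy :: "'b \<Rightarrow> real" where
  "energy x = (\<Sum>\<^sub>\<infinity>i\<in>I. (v i)\<^sup>2 * (norm (orth_proj (W i) x))\<^sup>2)"

abbreviation T :: "('i \<Rightarrow> 'b) \<Rightarrow> 'b" where "T \<equiv> synthesis I v"

lemma has_sum_coeffs: "((\<lambda>i. (norm (coeffs x i))\<^sup>2) has_sum energy x) I"
proof -
  have "((\<lambda>i. (v i)\<^sup>2 * (norm (orth_proj (W i) x))\<^sup>2) has_sum energy x) I"
    unfolding energy_def using energy_summable by simp
  then show ?thesis
    by (rule has_sum_cong[THEN iffD1, rotated]) (simp add: coeffs_def power_mult_distrib)
qed

lemma coeffs_in_l2_sum: "coeffs x \<in> l2_sum I W"
proof -
  have "coeffs x \<in> families I W"
    by (auto simp: coeffs_def families_def closed_subspace orth_proj_in subspace_W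
        intro!: subspace_scaleR)
  then show ?thesis
    using has_sum_coeffs[of x] by (auto simp: l2_sum_def summable_on_def)
qed

lemma single_in_l2_sum:
  assumes "i \<in> I" "x \<in> W i"
  shows "single i x \<in> l2_sum I W"
proof -
  have "((\<lambda>j. (norm (single i x j))\<^sup>2) has_sum (norm (single i x i))\<^sup>2) I"
    using assms(1) by (rule has_sum_single) (simp add: single_def)
  moreover have "single i x \<in> families I W"
    using subspace_W assms by (rule single_in_families)
  ultimately show ?thesis
    by (auto simp: l2_sum_def summable_on_def)
qed

lemma ip_coeffs:
  assumes "i \<in> I" "x \<in> W i"
  shows "ip x (coeffs y i) = of_real (v i) * ip x y"
  using assms by (simp add: coeffs_def ip_scaleR_right ip_orth_proj closed_subspace)

text \<open>
  With \<open>y\<close> the sum on the left, \<open>(norm y)\<^sup>2\<close> is the inner product of the finite family \<open>c\<close> with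
  \<open>coeffs y\<close>.  The Cauchy--Schwarz inequality and the upper frame bound for \<open>y\<close> give
  \<open>(norm y)^4 \<le> (\<Sum>i\<in>F. (norm (c i))\<^sup>2) * (D * (norm y)\<^sup>2)\<close>, and one factor \<open>(norm y)\<^sup>2\<close> cancels.
\<close>

lemma norm_partial_synthesis:
  assumes F: "finite F" "F \<subseteq> I" and c: "\<And>i. i \<in> F \<Longrightarrow> c i \<in> W i"
  shows "(norm (\<Sum>i\<in>F. v i *\<^sub>R c i))\<^sup>2 \<le> D * (\<Sum>i\<in>F. (norm (c i))\<^sup>2)"
proof -
  define y where "y = (\<Sum>i\<in>F. v i *\<^sub>R c i)"
  have "of_real ((norm y)\<^sup>2) = ip y y"
    by (simp only: ip_self)
  also have "\<dots> = (\<Sum>i\<in>F. ip (v i *\<^sub>R c i) y)"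
    by (subst (1) y_def) (simp add: ip_sum_left)
  also have "\<dots> = (\<Sum>i\<in>F. ip (c i) (coeffs y i))"
    using F c by (intro sum.cong) (auto simp: ip_scaleR_left ip_coeffs)
  finally have "norm (of_real ((norm y)\<^sup>2) :: 'k) = norm (\<Sum>i\<in>F. ip (c i) (coeffs y i))"
    by (rule arg_cong)
  then have "(norm y)\<^sup>2 = norm (\<Sum>i\<in>F. ip (c i) (coeffs y i))"
    by (simp add: norm_power)
  also have "\<dots> \<le> (\<Sum>i\<in>F. norm (c i) * norm (coeffs y i))"
    by (intro sum_norm_le norm_ip_le)
  finally have "((norm y)\<^sup>2)\<^sup>2 \<le> (\<Sum>i\<in>F. norm (c i) * norm (coeffs y i))\<^sup>2"
    by (intro power_mono) auto
  also have "\<dots> \<le> (\<Sum>i\<in>F. (norm (c i))\<^sup>2) * (\<Sum>i\<in>F. (norm (coeffs y i))\<^sup>2)"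
    by (rule Cauchy_Schwarz_ineq_sum)
  also have "\<dots> \<le> (\<Sum>i\<in>F. (norm (c i))\<^sup>2) * (D * (norm y)\<^sup>2)"
  proof (intro mult_left_mono sum_nonneg)
    have "(\<Sum>i\<in>F. (norm (coeffs y i))\<^sup>2) \<le> energy y"
      using has_sum_coeffs F by (metis finite_sum_le_has_sum zero_le_power2)
    also have "\<dots> \<le> D * (norm y)\<^sup>2"
      unfolding energy_def by (rule energy_upper)
    finally show "(\<Sum>i\<in>F. (norm (coeffs y i))\<^sup>2) \<le> D * (norm y)\<^sup>2" .
  qed simp
  finally have "(norm y)\<^sup>2 * (norm y)\<^sup>2 \<le> (D * (\<Sum>i\<in>F. (norm (c i))\<^sup>2)) * (norm y)\<^sup>2"
    by (simp add: power2_eq_square mult_ac)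
  moreover have "0 \<le> D * (\<Sum>i\<in>F. (norm (c i))\<^sup>2)"
    using lower_pos lower_le_upper by (intro mult_nonneg_nonneg sum_nonneg) auto
  ultimately show ?thesis
    unfolding y_def[symmetric]
    by (cases "y = 0") (auto intro: mult_right_le_imp_le[of _ "(norm y)\<^sup>2"])
qed

lemma has_sum_synthesis:
  assumes "c \<in> l2_sum I W"
  shows "((\<lambda>i. v i *\<^sub>R c i) has_sum T c) I"
proof -
  have "(\<lambda>i. v i *\<^sub>R c i) summable_on I"
  proof (rule summable_on_if_norm_sum_squared_le)
    show "(\<lambda>i. D * (norm (c i))\<^sup>2) summable_on I"
      using assms by (intro summable_on_cmult_right) (simp add: l2_sum_def)
    fix F assume "finite F" "F \<subseteq> I"
    with assms show "(norm (\<Sum>i\<in>F. v i *\<^sub>R c i))\<^sup>2 \<le> (\<Sum>i\<in>F. D * (norm (c i))\<^sup>2)"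
      unfolding sum_distrib_left[symmetric]
      by (intro norm_partial_synthesis) (auto simp: l2_sum_def families_def)
  qed
  then show ?thesis
    unfolding synthesis_def by simp
qed

lemma synthesis_diff:
  assumes "c \<in> l2_sum I W" "d \<in> l2_sum I W"
  shows "T (\<lambda>i. c i - d i) = T c - T d"
proof -
  have "((\<lambda>i. v i *\<^sub>R (c i - d i)) has_sum (T c - T d)) I"
    using has_sum_minus[OF has_sum_synthesis[OF assms(1)] has_sum_synthesis[OF assms(2)]]
    by (simp add: scaleR_diff_right)
  then show ?thesis
    unfolding synthesis_def by (rule infsumI)
qed

lemma has_sum_ip_coeffs:
  assumes "c \<in> l2_sum I W"
  shows "((\<lambda>i. ip (c i) (coeffs y i)) has_sum ip (T c) y) I"
proof -
  have "((\<lambda>i. ip (v i *\<^sub>R c i) y) has_sum ip (T c) y) I"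
    by (rule has_sum_bounded_linear[OF bounded_linear_ip_left has_sum_synthesis[OF assms]])
  then show ?thesis
    using assms
    by (subst has_sum_cong) (auto simp: ip_scaleR_left ip_coeffs l2_sum_def families_def)
qed

lemma l2_ip_single:
  assumes "i \<in> I"
  shows "l2_ip I (single i x) c = ip x (c i)"
proof -
  have "((\<lambda>j. ip (single i x j) (c j)) has_sum ip (single i x i) (c i)) I"
    using assms by (rule has_sum_single) (simp add: single_def)
  then show ?thesis
    unfolding l2_ip_def by (simp add: infsumI single_def)
qed

text \<open>
  Testing against families with a single nonzero term shows that an adjoint family is determined
  entry by entry.
\<close>

lemma analysis_eq_coeffs: "analysis I W v y = coeffs y"
  unfolding analysis_def hilbert_adjoint_def
proof (rule the_equality)
  show "coeffs y \<in> l2_sum I W \<and> (\<forall>z\<in>l2_sum I W. l2_ip I z (coeffs y) = ip (T z) y)"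
    using coeffs_in_l2_sum has_sum_ip_coeffs unfolding l2_ip_def by (auto intro: infsumI)
  fix c assume c: "c \<in> l2_sum I W \<and> (\<forall>z\<in>l2_sum I W. l2_ip I z c = ip (T z) y)"
  show "c = coeffs y"
  proof
    fix i
    show "c i = coeffs y i"
    proof (cases "i \<in> I")
      case True
      have *: "ip x (c i) = ip x (coeffs y i)" if "x \<in> W i" for x
      proof -
        have "ip x (c i) = l2_ip I (single i x) c"
          using True by (simp add: l2_ip_single)
        also have "\<dots> = ip (T (single i x)) y"
          using c single_in_l2_sum[OF True that] by blast
        also have "\<dots> = l2_ip I (single i x) (coeffs y)"
          unfolding l2_ip_def
          using has_sum_ip_coeffs[OF single_in_l2_sum[OF True that]] by (metis infsumI)
        finally show ?thesis
          using True by (simp add: l2_ip_single)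
      qed
      have "c i \<in> W i" "coeffs y i \<in> W i"
        using c coeffs_in_l2_sum[of y] True by (auto simp: l2_sum_def families_def)
      then have "c i - coeffs y i \<in> W i"
        using True by (simp add: subspace_diff subspace_W)
      from *[OF this] have "ip (c i - coeffs y i) (c i - coeffs y i) = 0"
        by (simp add: ip_diff_right)
      then show ?thesis by simp
    next
      case False
      then show ?thesis
        using c by (simp add: l2_sum_def families_def coeffs_def)
    qed
  qed
qed

lemma coeffs_diff: "coeffs (x - y) = (\<lambda>i. coeffs x i - coeffs y i)"
  by (auto simp: coeffs_def orth_proj_diff closed_subspace scaleR_diff_right)

text \<open>
  The bound for finite partial sums passes to the limit, and the upper frame bound controls the energy.
\<close>

lemma norm_synthesis_coeffs: "norm (T (coeffs x)) \<le> D * norm x"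
proof -
  have "0 \<le> D" using lower_pos lower_le_upper by simp
  have "((\<lambda>i. v i *\<^sub>R coeffs x i) has_sum T (coeffs x)) I"
    by (intro has_sum_synthesis coeffs_in_l2_sum)
  then have "((\<lambda>F. (norm (\<Sum>i\<in>F. v i *\<^sub>R coeffs x i))\<^sup>2) \<longlongrightarrow> (norm (T (coeffs x)))\<^sup>2)
      (finite_subsets_at_top I)"
    unfolding has_sum_def by (intro tendsto_intros)
  moreover have "((\<lambda>F. D * (\<Sum>i\<in>F. (norm (coeffs x i))\<^sup>2)) \<longlongrightarrow> D * energy x) (finite_subsets_at_top I)"
    using has_sum_coeffs[of x] unfolding has_sum_def by (intro tendsto_intros)
  moreover have "\<forall>\<^sub>F F in finite_subsets_at_top I.
      (norm (\<Sum>i\<in>F. v i *\<^sub>R coeffs x i))\<^sup>2 \<le> D * (\<Sum>i\<in>F. (norm (coeffs x i))\<^sup>2)"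
    using coeffs_in_l2_sum[of x]
    by (intro eventually_finite_subsets_at_top_weakI norm_partial_synthesis)
      (auto simp: l2_sum_def families_def)
  ultimately have "(norm (T (coeffs x)))\<^sup>2 \<le> D * energy x"
    by (intro tendsto_le[OF finite_subsets_at_top_neq_bot])
  also have "\<dots> \<le> D * (D * (norm x)\<^sup>2)"
    using \<open>0 \<le> D\<close> energy_upper unfolding energy_def by (intro mult_left_mono) auto
  also have "\<dots> = (D * norm x)\<^sup>2"
    by (simp add: power2_eq_square)
  finally show ?thesis
    by (rule power2_le_imp_le) (use \<open>0 \<le> D\<close> in simp)
qed

lemma ip_synthesis_coeffs: "ip (T (coeffs x)) x = of_real (energy x)"
proof -
  have "((\<lambda>i. of_real ((norm (coeffs x i))\<^sup>2)) has_sum ip (T (coeffs x)) x) I"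
    using has_sum_ip_coeffs[OF coeffs_in_l2_sum, of x x] unfolding ip_self .
  moreover have "((\<lambda>i. of_real ((norm (coeffs x i))\<^sup>2) :: 'k) has_sum of_real (energy x)) I"
    by (rule has_sum_of_real[OF has_sum_coeffs])
  ultimately show ?thesis
    by (rule has_sum_unique)
qed

text \<open>
  Solving \<open>S x = y\<close> means finding a fixed point of \<open>x \<mapsto> x - t *\<^sub>R S x + t *\<^sub>R y\<close>.  From
  \<open>\<langle>S x, x\<rangle> \<ge> C * (norm x)\<^sup>2\<close> and \<open>norm (S x) \<le> D * norm x\<close> one gets
  \<open>(norm (x - t *\<^sub>R S x))\<^sup>2 \<le> (1 - 2 * t * C + t\<^sup>2 * D\<^sup>2) * (norm x)\<^sup>2\<close>.  The choice \<open>t = C / D\<^sup>2\<close>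
  minimises the factor, which becomes \<open>1 - C\<^sup>2 / D\<^sup>2 < 1\<close>, so the map is a contraction.
\<close>

lemma frame_operator_surj: "\<exists>x. T (coeffs x) = y"
proof -
  define S where "S x = T (coeffs x)" for x
  define t where "t = C / D\<^sup>2"
  define q where "q = sqrt (1 - C\<^sup>2 / D\<^sup>2)"
  have D: "0 < D" using lower_pos lower_le_upper by simp
  have q_arg: "0 \<le> 1 - C\<^sup>2 / D\<^sup>2"
    using D lower_pos lower_le_upper by (simp add: divide_le_eq power_mono)
  have S_diff: "S (x - z) = S x - S z" for x z
    unfolding S_def coeffs_diff by (intro synthesis_diff coeffs_in_l2_sum)
  have S_left: "ip (S x) x = of_real (energy x)" for x
    unfolding S_def by (rule ip_synthesis_coeffs)
  have S_right: "ip x (S x) = of_real (energy x)" for x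
    using ip_cnj_commute[of x "S x"] by (simp add: S_left)
  have contr: "norm (x - t *\<^sub>R S x) \<le> q * norm x" for x
  proof -
    have "of_real ((norm (x - t *\<^sub>R S x))\<^sup>2) = ip (x - t *\<^sub>R S x) (x - t *\<^sub>R S x)"
      by (simp only: ip_self)
    also have "\<dots> = of_real ((norm x)\<^sup>2 - 2 * t * energy x + t\<^sup>2 * (norm (S x))\<^sup>2)"
      by (simp add: ip_diff_left ip_diff_right ip_scaleR_left ip_scaleR_right S_left S_right
          ip_self[of x] ip_self[of "S x"] power2_eq_square algebra_simps)
    finally have "(norm (x - t *\<^sub>R S x))\<^sup>2 = (norm x)\<^sup>2 - 2 * t * energy x + t\<^sup>2 * (norm (S x))\<^sup>2"
      unfolding of_real_eq_iff .
    also have "\<dots> \<le> (norm x)\<^sup>2 - 2 * t * (C * (norm x)\<^sup>2) + t\<^sup>2 * (D * norm x)\<^sup>2"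
    proof -
      have "0 \<le> t" using D lower_pos by (simp add: t_def)
      then have "2 * t * (C * (norm x)\<^sup>2) \<le> 2 * t * energy x"
        using energy_lower[of x] unfolding energy_def by (intro mult_left_mono) auto
      moreover have "(norm (S x))\<^sup>2 \<le> (D * norm x)\<^sup>2"
        unfolding S_def by (intro power_mono norm_synthesis_coeffs norm_ge_zero)
      then have "t\<^sup>2 * (norm (S x))\<^sup>2 \<le> t\<^sup>2 * (D * norm x)\<^sup>2"
        by (rule mult_left_mono) simp
      ultimately show ?thesis by linarith
    qed
    also have "\<dots> = (1 - C\<^sup>2 / D\<^sup>2) * (norm x)\<^sup>2"
      using D by (simp add: t_def field_simps power2_eq_square)
    also have "\<dots> = (q * norm x)\<^sup>2"
      using q_arg by (simp add: q_def power_mult_distrib)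
    finally show ?thesis
      by (rule power2_le_imp_le) (use q_arg in \<open>simp add: q_def\<close>)
  qed
  have "\<exists>!x. x - t *\<^sub>R S x + t *\<^sub>R y = x"
  proof (rule banach_fix_type)
    show "0 \<le> q" using q_arg by (simp add: q_def)
    show "q < 1" using D lower_pos by (simp add: q_def)
    show "\<forall>x z. dist (x - t *\<^sub>R S x + t *\<^sub>R y) (z - t *\<^sub>R S z + t *\<^sub>R y) \<le> q * dist x z"
    proof (intro allI)
      fix x z
      have "(x - t *\<^sub>R S x + t *\<^sub>R y) - (z - t *\<^sub>R S z + t *\<^sub>R y) = (x - z) - t *\<^sub>R S (x - z)"
        by (simp add: S_diff algebra_simps)
      then show "dist (x - t *\<^sub>R S x + t *\<^sub>R y) (z - t *\<^sub>R S z + t *\<^sub>R y) \<le> q * dist x z"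
        using contr[of "x - z"] by (simp only: dist_norm)
    qed
  qed
  then obtain x where "x - t *\<^sub>R S x + t *\<^sub>R y = x" by blast
  then have "t *\<^sub>R S x = t *\<^sub>R y"
    by (metis add.commute add_diff_cancel_left' diff_add_cancel diff_diff_eq2)
  moreover have "t \<noteq> 0" using D lower_pos by (simp add: t_def)
  ultimately have "S x = y" by simp
  then show ?thesis unfolding S_def by blast
qed

lemma ex_expansion: "\<exists>g\<in>families I W. (g has_sum x) I"
proof -
  obtain y where y: "T (coeffs y) = x"
    using frame_operator_surj by blast
  have "(\<lambda>i. v i *\<^sub>R coeffs y i) \<in> families I W"
    using coeffs_in_l2_sum[of y]
    by (auto simp: l2_sum_def families_def intro!: subspace_scaleR subspace_W)
  moreover have "((\<lambda>i. v i *\<^sub>R coeffs y i) has_sum x) I"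
    using has_sum_synthesis[OF coeffs_in_l2_sum, of y] by (simp add: y)
  ultimately show ?thesis by blast
qed

lemma frame: "frame_of_subspaces I W v"
  unfolding frame_of_subspaces_def
  using closed_subspace weight_pos lower_pos lower_le_upper energy_summable energy_lower energy_upper
  by blast

section \<open>The cycle of implications\<close>

lemma riesz_imp_inj_synthesis:
  assumes "riesz_decomposition I W"
  shows "inj_on T (l2_sum I W)"
proof (rule inj_onI, rule ext)
  fix c d i assume c: "c \<in> l2_sum I W" and d: "d \<in> l2_sum I W" and eq: "T c = T d"
  have fam: "(\<lambda>i. v i *\<^sub>R e i) \<in> families I W" if "e \<in> l2_sum I W" for e
    using that by (auto simp: l2_sum_def families_def intro!: subspace_scaleR subspace_W)
  have "(\<lambda>i. v i *\<^sub>R c i) = (\<lambda>i. v i *\<^sub>R d i)"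
    using assms fam[OF c] fam[OF d] has_sum_synthesis[OF c] has_sum_synthesis[OF d] eq
    unfolding riesz_decomposition_def by metis
  then have "v i *\<^sub>R c i = v i *\<^sub>R d i" by (rule fun_cong)
  then show "c i = d i"
    using weight_pos[of i] c d by (cases "i \<in> I") (auto simp: l2_sum_def families_def)
qed

text \<open>
  The frame operator factors as \<open>T\<close> after \<open>coeffs\<close> and is onto, so every value of \<open>T\<close> is already
  attained on a family of the form \<open>coeffs x\<close>.
\<close>

lemma inj_synthesis_imp_surj_analysis:
  assumes "inj_on T (l2_sum I W)"
  shows "range (analysis I W v) = l2_sum I W"
proof -
  have "c \<in> range coeffs" if c: "c \<in> l2_sum I W" for c
  proof -
    obtain x where "T (coeffs x) = T c"
      using frame_operator_surj by blast
    then have "coeffs x = c"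
      using assms c coeffs_in_l2_sum by (auto dest: inj_onD)
    then show ?thesis by blast
  qed
  then show ?thesis
    using coeffs_in_l2_sum by (auto simp: analysis_eq_coeffs)
qed

text \<open>
  A vector \<open>y\<close> with \<open>coeffs y = single i x\<close> separates \<open>x\<close> from the other subspaces: it is orthogonal
  to all of them, but not to \<open>x\<close> unless \<open>x = 0\<close>.
\<close>

lemma surj_analysis_imp_minimal:
  assumes surj: "range (analysis I W v) = l2_sum I W"
  shows "minimal_family I W"
  unfolding minimal_family_def
proof (intro ballI equalityI subsetI)
  fix i x assume i: "i \<in> I" and x: "x \<in> W i \<inter> closure (span (\<Union>j\<in>I - {i}. W j))"
  have "single i x \<in> range (analysis I W v)"
    unfolding surj using i x by (intro single_in_l2_sum) auto
  then obtain y where y: "coeffs y = single i x"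
    by (auto simp: analysis_eq_coeffs)
  have "ip w y = 0" if "w \<in> (\<Union>j\<in>I - {i}. W j)" for w
  proof -
    from that obtain j where j: "j \<in> I" "j \<noteq> i" "w \<in> W j" by blast
    then have "of_real (v j) * ip w y = 0"
      using ip_coeffs[of j w y] by (simp add: y single_def)
    with weight_pos[OF j(1)] show ?thesis by simp
  qed
  moreover have "x \<in> closure (span (\<Union>j\<in>I - {i}. W j))" "x \<in> W i"
    using x by auto
  ultimately have "ip x y = 0"
    using ip_eq_0_on_closure_span[of "\<Union>j\<in>I - {i}. W j" y x] by simp
  then have "ip x x = 0"
    using ip_coeffs[OF i \<open>x \<in> W i\<close>, of y] by (simp add: y single_def)
  then show "x \<in> {0}" by simp
next
  fix i x assume "i \<in> I" "x \<in> {0::'b}"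
  then show "x \<in> W i \<inter> closure (span (\<Union>j\<in>I - {i}. W j))"
    using subspace_0[OF subspace_W] subsetD[OF closure_subset span_zero] by simp
qed

lemma minimal_imp_riesz:
  assumes "minimal_family I W"
  shows "riesz_decomposition I W"
  unfolding riesz_decomposition_def
  using frame ex_expansion minimal_unique_sum[OF subspace_W assms] by blast

end

section \<open>Exactness\<close>

context hilbert_space
begin

text \<open>
  A frame without \<open>W i\<close> would expand a nonzero \<open>x \<in> W i\<close> in the other subspaces, while \<open>x\<close> is also its
  own expansion with a single term at \<open>i\<close>.
\<close>

lemma riesz_decomposition_imp_exact:
  assumes riesz: "riesz_decomposition I W" and nonzero: "\<And>i. i \<in> I \<Longrightarrow> W i \<noteq> {0}"
  shows "exact_frame_of_subspaces I W"
proof -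
  obtain v where v: "frame_of_subspaces I W v"
    using riesz by (auto simp: riesz_decomposition_def)
  have sub: "subspace (W j)" if "j \<in> I" for j
    using v that by (simp add: frame_of_subspaces_def closed_subspace_def)
  have "\<not> frame_of_subspaces (I - {i}) W u" if i: "i \<in> I" for i u
  proof
    assume "frame_of_subspaces (I - {i}) W u"
    then obtain C D where "subspace_frame scale ip (I - {i}) W u C D"
      by (rule frame_of_subspacesE)
    then interpret r: subspace_frame scale ip "I - {i}" W u C D .
    obtain x where x: "x \<in> W i" "x \<noteq> 0"
      using nonzero[OF i] subspace_0[OF sub[OF i]] by blast
    obtain g where g: "g \<in> families (I - {i}) W" "(g has_sum x) (I - {i})"
      using r.ex_expansion by blast
    have gi: "g i = 0" using g(1) by (simp add: families_def)
    have "g \<in> families I W"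
      using g(1) gi i subspace_0[OF sub[OF i]] by (auto simp: families_def)
    moreover have "(g has_sum x) I"
      using g(2) by (rule has_sum_cong_neutral[THEN iffD1, rotated -1]) (auto simp: gi)
    moreover have "single i x \<in> families I W"
      using sub i x(1) by (rule single_in_families)
    moreover have "(single i x has_sum x) I"
      using has_sum_single[OF i, of "single i x"] by (simp add: single_def)
    ultimately have "g = single i x"
      using riesz unfolding riesz_decomposition_def by blast
    with gi x(2) show False by (simp add: single_def)
  qed
  with v show ?thesis
    unfolding exact_frame_of_subspaces_def by blast
qed

end

section \<open>An exact frame that is not a Riesz decomposition\<close>

definition vec_ip :: "'k::hilbert_scalar ^ 'n \<Rightarrow> 'k ^ 'n \<Rightarrow> 'k" where
  "vec_ip x y = (\<Sum>i\<in>UNIV. x $ i * scnj (y $ i))"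

lemma norm_vec_squared: "(norm (x :: 'a::real_normed_vector ^ 'n))\<^sup>2 = (\<Sum>i\<in>UNIV. (norm (x $ i))\<^sup>2)"
  by (simp add: norm_vec_def L2_set_def sum_nonneg)

lemma scnj_sum: "scnj (sum f A) = (\<Sum>i\<in>A. scnj (f i) :: 'k::hilbert_scalar)"
  by (induction A rule: infinite_finite_induct) (auto simp: scnj_add)

lemma hilbert_space_vec: "hilbert_space (*s) (vec_ip :: 'k::hilbert_scalar ^ 'n \<Rightarrow> _)"
proof unfold_locales
  fix x y z :: "'k ^ 'n" and c :: 'k and r :: real
  show "of_real r *s x = r *\<^sub>R x"
    by (simp add: vec_eq_iff scaleR_conv_of_real[of r "_ :: 'k"])
  show "vec_ip (x + y) z = vec_ip x z + vec_ip y z"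
    by (simp add: vec_ip_def distrib_right sum.distrib)
  show "vec_ip (c *s x) y = c * vec_ip x y"
    by (simp add: vec_ip_def sum_distrib_left mult.assoc)
  show "vec_ip y x = scnj (vec_ip x y)"
    by (simp add: vec_ip_def scnj_sum scnj_mult scnj_scnj mult.commute)
  show "vec_ip x x = of_real ((norm x)\<^sup>2)"
    unfolding norm_vec_squared vec_ip_def mult_scnj' by simp
qed

interpretation kn: hilbert_space "(*s)" "vec_ip :: 'k::hilbert_scalar ^ 'n \<Rightarrow> _"
  by (rule hilbert_space_vec)

lemma closed_subspace_coordinate_hyperplane:
  "kn.closed_subspace {x :: 'k::hilbert_scalar ^ 'n. x $ k = 0}"
  unfolding kn.closed_subspace_def
  by (intro conjI vec.subspaceI closed_Collect_eq continuous_intros) auto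

lemma orth_proj_coordinate_hyperplane:
  "kn.orth_proj {x :: 'k::hilbert_scalar ^ 'n. x $ k = 0} x = (\<chi> i. if i = k then 0 else x $ i)"
  by (rule kn.orth_proj_eqI[OF closed_subspace_coordinate_hyperplane])
    (auto simp: vec_ip_def intro!: sum.neutral)

lemma norm_orth_proj_coordinate_hyperplane:
  "(norm (kn.orth_proj {x :: 'k::hilbert_scalar ^ 'n. x $ k = 0} x))\<^sup>2 = (norm x)\<^sup>2 - (norm (x $ k))\<^sup>2"
proof -
  have "(\<Sum>i\<in>UNIV. (norm ((\<chi> i. if i = k then 0 else x $ i) $ i))\<^sup>2) = (\<Sum>i\<in>UNIV - {k}. (norm (x $ i))\<^sup>2)"
    by (intro sum.mono_neutral_cong_right) auto
  then show ?thesis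
    unfolding orth_proj_coordinate_hyperplane norm_vec_squared by (simp add: sum_diff1)
qed

text \<open>
  The projection on the hyperplane kills the coordinate vector orthogonal to it, against the lower
  frame bound.
\<close>

lemma not_frame_coordinate_hyperplane:
  "\<not> kn.frame_of_subspaces {j} (\<lambda>j. {x :: 'k::hilbert_scalar ^ 'n. x $ c j = 0}) u"
proof
  let ?U = "\<lambda>j. {x :: 'k ^ 'n. x $ c j = 0}"
  assume "kn.frame_of_subspaces {j} ?U u"
  then obtain B where B: "0 < B"
    "\<And>x. B * (norm x)\<^sup>2 \<le> (\<Sum>\<^sub>\<infinity>i\<in>{j}. (u i)\<^sup>2 * (norm (kn.orth_proj (?U i) x))\<^sup>2)"
    unfolding kn.frame_of_subspaces_def by blast
  have "(norm (axis (c j) 1 :: 'k ^ 'n))\<^sup>2 = 1"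
  proof -
    have "(norm ((axis (c j) 1 :: 'k ^ 'n) $ i))\<^sup>2 = (if i = c j then 1 else 0)" for i
      by (simp add: axis_def)
    then show ?thesis
      unfolding norm_vec_squared by simp
  qed
  then show False
    using B(1) B(2)[of "axis (c j) 1"]
    by (simp add: norm_orth_proj_coordinate_hyperplane)
qed

text \<open>
  The planes spanned by the coordinate vectors 2, 3 and by 1, 2; they meet in the line of the second one.
\<close>

definition coordinate_planes :: "nat \<Rightarrow> ('k::hilbert_scalar ^ 3) set" where
  "coordinate_planes j = {x. x $ (if j = 0 then 1 else 3) = 0}"

text \<open>
  With unit weights the energy of \<open>x\<close> is
  \<open>2 * (norm x)\<^sup>2 - (norm (x $ 1))\<^sup>2 - (norm (x $ 3))\<^sup>2\<close>, which lies between
  \<open>(norm x)\<^sup>2\<close> and \<open>2 * (norm x)\<^sup>2\<close>.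
\<close>

lemma exact_frame_coordinate_planes:
  "kn.exact_frame_of_subspaces {0, 1} (coordinate_planes :: nat \<Rightarrow> ('k::hilbert_scalar ^ 3) set)"
proof -
  let ?U = "coordinate_planes :: nat \<Rightarrow> ('k ^ 3) set"
  have closed: "kn.closed_subspace (?U j)" for j
    unfolding coordinate_planes_def by (rule closed_subspace_coordinate_hyperplane)
  have "kn.frame_of_subspaces {0, 1} ?U (\<lambda>_. 1)"
    unfolding kn.frame_of_subspaces_def
  proof (rule conjI, blast intro: closed zero_less_one, rule exI[of _ 1], rule exI[of _ 2], intro conjI allI)
    fix x :: "'k ^ 3"
    have *: "(\<Sum>\<^sub>\<infinity>j\<in>{0, 1}. 1\<^sup>2 * (norm (kn.orth_proj (?U j) x))\<^sup>2) =
        2 * (norm x)\<^sup>2 - (norm (x $ 1))\<^sup>2 - (norm (x $ 3))\<^sup>2"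
      by (simp add: coordinate_planes_def norm_orth_proj_coordinate_hyperplane)
    have **: "(norm x)\<^sup>2 = (norm (x $ 1))\<^sup>2 + (norm (x $ 2))\<^sup>2 + (norm (x $ 3))\<^sup>2"
      by (simp add: norm_vec_squared sum_3)
    show "1 * (norm x)\<^sup>2 \<le> (\<Sum>\<^sub>\<infinity>j\<in>{0, 1}. 1\<^sup>2 * (norm (kn.orth_proj (?U j) x))\<^sup>2)"
      unfolding * using ** by simp
    show "(\<Sum>\<^sub>\<infinity>j\<in>{0, 1}. 1\<^sup>2 * (norm (kn.orth_proj (?U j) x))\<^sup>2) \<le> 2 * (norm x)\<^sup>2"
      unfolding * by simp
  qed simp_all
  moreover have "\<nexists>u. kn.frame_of_subspaces ({0, 1} - {i}) ?U u" if "i \<in> {0, 1}" for i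
  proof -
    have rest: "{0, 1} - {i} = {1 - i}" using that by auto
    have planes: "?U = (\<lambda>j. {x. x $ (if j = 0 then 1 else 3) = 0})"
      by (rule ext) (rule coordinate_planes_def)
    show ?thesis
      unfolding rest planes by (intro notI, elim exE, rule notE[OF not_frame_coordinate_hyperplane])
  qed
  ultimately show ?thesis
    unfolding kn.exact_frame_of_subspaces_def by (intro conjI exI ballI) simp_all
qed

text \<open>
  The second coordinate vector can be placed in either of the two planes.
\<close>

lemma not_riesz_coordinate_planes:
  "\<not> kn.riesz_decomposition {0, 1} (coordinate_planes :: nat \<Rightarrow> ('k::hilbert_scalar ^ 3) set)"
proof
  let ?U = "coordinate_planes :: nat \<Rightarrow> ('k ^ 3) set"
  assume riesz: "kn.riesz_decomposition {0, 1} ?U"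
  define e where "e = (axis 2 1 :: 'k ^ 3)"
  define g where "g k = (\<lambda>j::nat. if j = k then e else 0)" for k
  have e: "e $ 1 = 0" "e $ 3 = 0" "e $ 2 = 1"
    by (auto simp: e_def axis_def)
  have "g k \<in> kn.families {0, 1} ?U \<and> (g k has_sum e) {0, 1}" if "k \<in> {0, 1}" for k
    using that by (auto simp: g_def kn.families_def coordinate_planes_def e intro!: has_sum_finiteI)
  from this[of 0] this[of 1] have "g 0 = g 1"
    using riesz unfolding kn.riesz_decomposition_def by blast
  then have "g 0 0 = g 1 0" by simp
  then have "e = 0" by (simp add: g_def)
  with e(3) show False by simp
qed

section \<open>Equivalent conditions for a Riesz decomposition\<close>

theorem theorem4p6:
  fixes scale :: "'k::hilbert_scalar \<Rightarrow> 'h::banach \<Rightarrow> 'h"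
    and ip :: "'h \<Rightarrow> 'h \<Rightarrow> 'k"
    and I :: "'i set"
    and W :: "'i \<Rightarrow> 'h set"
    and v :: "'i \<Rightarrow> real"
  assumes "hilbert_space scale ip"
    and "separable_space (euclidean :: 'h topology)"
    and "hilbert_space.frame_of_subspaces scale ip I W v"
  shows
    "((hilbert_space.riesz_decomposition scale ip I W
         \<longleftrightarrow> hilbert_space.minimal_family scale I W) \<and>
      (hilbert_space.minimal_family scale I W
         \<longleftrightarrow> inj_on (hilbert_space.synthesis I v) (hilbert_space.l2_sum I W)) \<and>
      (inj_on (hilbert_space.synthesis I v) (hilbert_space.l2_sum I W)
         \<longleftrightarrow> hilbert_space.analysis ip I W v ` UNIV = hilbert_space.l2_sum I W)) \<and>
     ((\<forall>i\<in>I. W i \<noteq> {0}) \<longrightarrow>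
        hilbert_space.riesz_decomposition scale ip I W \<longrightarrow>
        hilbert_space.exact_frame_of_subspaces scale ip I W) \<and>
     (\<exists>(scale' :: 'k \<Rightarrow> 'k ^ 3 \<Rightarrow> 'k ^ 3) ip' (J :: nat set) U.
        hilbert_space scale' ip' \<and>
        separable_space (euclidean :: ('k ^ 3) topology) \<and>
        hilbert_space.exact_frame_of_subspaces scale' ip' J U \<and>
        \<not> hilbert_space.riesz_decomposition scale' ip' J U)"
proof -
  interpret hilbert_space scale ip by fact
  obtain C D where "subspace_frame scale ip I W v C D"
    using assms(3) by (rule frame_of_subspacesE)
  then interpret subspace_frame scale ip I W v C D .
  have "(riesz_decomposition I W \<longleftrightarrow> minimal_family I W) \<and>
      (minimal_family I W \<longleftrightarrow> inj_on T (l2_sum I W)) \<and>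
      (inj_on T (l2_sum I W) \<longleftrightarrow> range (analysis I W v) = l2_sum I W)"
    using riesz_imp_inj_synthesis inj_synthesis_imp_surj_analysis surj_analysis_imp_minimal
      minimal_imp_riesz by (intro conjI iffI) simp_all
  moreover have "(\<forall>i\<in>I. W i \<noteq> {0}) \<longrightarrow> riesz_decomposition I W \<longrightarrow> exact_frame_of_subspaces I W"
    by (intro impI riesz_decomposition_imp_exact) simp_all
  moreover have "\<exists>(scale' :: 'k \<Rightarrow> 'k ^ 3 \<Rightarrow> 'k ^ 3) ip' (J :: nat set) U.
        hilbert_space scale' ip' \<and>
        separable_space (euclidean :: ('k ^ 3) topology) \<and>
        hilbert_space.exact_frame_of_subspaces scale' ip' J U \<and>
        \<not> hilbert_space.riesz_decomposition scale' ip' J U"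
    by (rule exI[of _ "(*s)"], rule exI[of _ vec_ip], rule exI[of _ "{0, 1}"],
        rule exI[of _ coordinate_planes])
      (intro conjI hilbert_space_vec separable_space_hilbert_scalar_vec
        exact_frame_coordinate_planes not_riesz_coordinate_planes)
  ultimately show ?thesis by (rule conjI[OF _ conjI])
qed

end
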